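(* (Duality Formula) For every nonzero $\mu\in\widetilde{\mathcal E}$, $z\big(\sum\mu\widetilde H\big)=\sum\bar\mu H$.
   Context: A coefficient function is a sequence $\mu=(\mu_1,\mu_2,\dots)$ of non-negative integers; it has finite support if only finitely many $\mu_k$ are nonzero. For a sequence $G$, $\sum\mu G:=\sum_{k\ge1}\mu_kG_k$. For $n\ge1$, $\mathrm{rev}_n(\mu)=(\mu_n,\mu_{n-1},\dots,\mu_1,0,0,\dots)$. For finite-support $\mu\ne\mu'$, $\mu<_a\mu'$ means $\mu_k<\mu'_k$ for the largest $k$ with $\mu_k\ne\mu'_k$. For a list $L=(e_1,\dots,e_N)$ of non-negative integers with $N\ge2$, $e_1\ne0$, let $\beta^*$ be the coefficient function with $\beta^*_k=e_j$ whenever $k\equiv j\pmod N$, $1\le j\le N$; for $n\ge2$ let $\theta^n=\mathrm{rev}_{n-1}(\beta^* )$ (the maximal $L$-block at index $n-1$, support interval $[1,n-1]$). A proper $L$-block at index $n-1$ ($n\ge2$) is a coefficient function $\zeta$ such that for some $k\in[1,n-1]$: $\zeta_j=\theta^n_j$ for $j>k$, $\zeta_k<\theta^n_k$, $\zeta_j=0$ for $j<k$; its support interval is $[k,n-1]$. The periodic Zeckendorf collection for positive integers determined by $L$ is the set of all finite sums (including $0$) of $L$-blocks with pairwise disjoint support intervals. Its fundamental sequence $H$ is given by $H_1=1$, $H_n=1+\sum\theta^nH$ ($n\ge2$); $\epsilon\mapsto\sum\epsilon H$ is a bijection from the collection onto $\mathbb Z_{\ge0}$, strictly increasing for $<_a$.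 Let $\mathcal E\subsetneq\widetilde{\mathcal E}$ be the periodic Zeckendorf collections for positive integers determined by two such lists $L$ and $\widetilde L$, with fundamental sequences $H$ and $\widetilde H$. For a positive integer $x$, $z(x)$ is the number of integers $n$ with $0\le n<x$ such that $n=\sum\epsilon\widetilde H$ for some $\epsilon\in\mathcal E$. For nonzero finite-support $\mu$, $\check\mu$ is the $<_a$-largest element of $\mathcal E$ that is $<_a\mu$, and $\bar\mu$ is the $<_a$-smallest element of $\mathcal E$ that is $>_a\check\mu$. *)

theory Defs
  imports Main "HOL-Library.Disjoint_Sets"
begin

text \<open>Coefficient functions and sequences are indexed by the positive integers. They are
  represented as functions on \<^typ>\<open>nat\<close>; a coefficient function has the value 0 at the
  unused index 0.\<close>

type_synonym coeff = "nat \<Rightarrow> nat"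

definition csum :: "coeff \<Rightarrow> (nat \<Rightarrow> nat) \<Rightarrow> nat" where
  "csum \<mu> G = (\<Sum>k | k \<ge> 1 \<and> \<mu> k \<noteq> 0. \<mu> k * G k)"

definition rev_coeff :: "nat \<Rightarrow> coeff \<Rightarrow> coeff" where
  "rev_coeff n \<mu> = (\<lambda>k. if 1 \<le> k \<and> k \<le> n then \<mu> (n + 1 - k) else 0)"

definition less_a :: "coeff \<Rightarrow> coeff \<Rightarrow> bool"  (infix \<open><\<^sub>a\<close> 50) where
  "\<mu> <\<^sub>a \<mu>' \<longleftrightarrow> (\<exists>k. \<mu> k \<noteq> \<mu>' k \<and> (\<forall>j>k. \<mu> j = \<mu>' j) \<and> \<mu> k < \<mu>' k)"

definition zeck_list :: "nat list \<Rightarrow> bool" where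
  "zeck_list L \<longleftrightarrow> length L \<ge> 2 \<and> L ! 0 \<noteq> 0"

text \<open>The list entry \<open>e\<^sub>j\<close> is \<open>L ! (j - 1)\<close>.\<close>

definition beta_star :: "nat list \<Rightarrow> coeff" where
  "beta_star L = (\<lambda>k. if k = 0 then 0 else L ! ((k - 1) mod length L))"

definition theta :: "nat list \<Rightarrow> nat \<Rightarrow> coeff" where
  "theta L n = rev_coeff (n - 1) (beta_star L)"

text \<open>\<open>L_block L \<zeta> a b\<close>: \<open>\<zeta>\<close> is an \<open>L\<close>-block at index \<open>b\<close> with support interval \<open>[a, b]\<close>.
  The zero function is a proper block for several intervals, so the interval has to be
  carried along with the function.\<close>

definition maximal_block :: "nat list \<Rightarrow> coeff \<Rightarrow> nat \<Rightarrow> nat \<Rightarrow> bool" where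
  "maximal_block L \<zeta> a b \<longleftrightarrow> (\<exists>n\<ge>2. \<zeta> = theta L n \<and> a = 1 \<and> b = n - 1)"

definition proper_block :: "nat list \<Rightarrow> coeff \<Rightarrow> nat \<Rightarrow> nat \<Rightarrow> bool" where
  "proper_block L \<zeta> a b \<longleftrightarrow>
    (\<exists>n\<ge>2. \<exists>k\<in>{1..n - 1}.
       (\<forall>j>k. \<zeta> j = theta L n j) \<and> \<zeta> k < theta L n k \<and> (\<forall>j<k. \<zeta> j = 0) \<and>
       a = k \<and> b = n - 1)"

definition L_block :: "nat list \<Rightarrow> coeff \<Rightarrow> nat \<Rightarrow> nat \<Rightarrow> bool" where
  "L_block L \<zeta> a b \<longleftrightarrow> maximal_block L \<zeta> a b \<or> proper_block L \<zeta> a b"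

text \<open>A family of blocks with pairwise disjoint support intervals has no repetitions, because
  support intervals are nonempty; hence sums over finite sets of blocks suffice.\<close>

definition zeck_collection :: "nat list \<Rightarrow> coeff set" where
  "zeck_collection L =
    {\<epsilon>. \<exists>B :: (coeff \<times> nat \<times> nat) set.
        finite B \<and> (\<forall>(\<zeta>, a, b)\<in>B. L_block L \<zeta> a b) \<and>
        disjoint_family_on (\<lambda>(\<zeta>, a, b). {a..b}) B \<and>
        \<epsilon> = (\<lambda>j. \<Sum>(\<zeta>, a, b)\<in>B. \<zeta> j)}"

fun fund_seq :: "nat list \<Rightarrow> nat \<Rightarrow> nat" where
  "fund_seq L n =
    (if n = 0 then 0 else if n = 1 then 1
     else 1 + (\<Sum>k = 1..<n. theta L n k * fund_seq L k))"

declare fund_seq.simps [simp del]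

lemma fund_seq_1: "fund_seq L 1 = 1"
  by (simp add: fund_seq.simps)

lemma fund_seq_rec:
  assumes "n \<ge> 2"
  shows "fund_seq L n = 1 + csum (theta L n) (fund_seq L)"
proof -
  have "csum (theta L n) (fund_seq L) = (\<Sum>k = 1..<n. theta L n k * fund_seq L k)"
    unfolding csum_def
    by (rule sum.mono_neutral_left) (auto simp: theta_def rev_coeff_def split: if_splits)
  with assms show ?thesis
    by (simp add: fund_seq.simps [of L n])
qed

definition z_count :: "nat list \<Rightarrow> nat list \<Rightarrow> nat \<Rightarrow> nat" where
  "z_count L L' x =
    card {n. n < x \<and> (\<exists>\<epsilon>\<in>zeck_collection L. n = csum \<epsilon> (fund_seq L'))}"

definition check_coeff :: "coeff set \<Rightarrow> coeff \<Rightarrow> coeff" where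
  "check_coeff E \<mu> =
    (THE \<epsilon>. \<epsilon> \<in> E \<and> \<epsilon> <\<^sub>a \<mu> \<and> (\<forall>\<delta>\<in>E. \<delta> <\<^sub>a \<mu> \<longrightarrow> \<delta> = \<epsilon> \<or> \<delta> <\<^sub>a \<epsilon>))"

definition bar_coeff :: "coeff set \<Rightarrow> coeff \<Rightarrow> coeff" where
  "bar_coeff E \<mu> =
    (THE \<epsilon>. \<epsilon> \<in> E \<and> check_coeff E \<mu> <\<^sub>a \<epsilon> \<and>
       (\<forall>\<delta>\<in>E. check_coeff E \<mu> <\<^sub>a \<delta> \<longrightarrow> \<delta> = \<epsilon> \<or> \<epsilon> <\<^sub>a \<delta>))"

end

theory Submission
  imports Defs
begin

text \<open>For each list, \<open>\<epsilon> \<mapsto> \<Sum>\<epsilon>H\<close> is an order isomorphism from the collection, ordered by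
  \<open><\<^sub>a\<close>, onto the natural numbers: an element supported below \<open>n\<close> follows the maximal block
  \<open>\<theta>\<^sup>n\<close> from the top down to a first index \<open>k\<close> where its digit is smaller, and continues there
  with an arbitrary element supported below \<open>k\<close>; the recursion for \<open>H\<close> counts exactly these
  choices. Applied to the larger collection, this turns \<open>z(\<Sum>\<mu>H')\<close> into the number of elements
  of the smaller collection that lie below \<open>\<mu>\<close>. Applied to the smaller one, that number is the
  rank of the successor of the largest such element.\<close>

section \<open>Recursive form of the collection\<close>

text \<open>Departure from the maximal block at place \<open>k\<close>. With the zero function for
  \<open>\<epsilon>\<close>, \<open>1 \<le> k < n\<close> and \<open>d < theta L n k\<close>, this
  is the proper block with support interval \<open>[k, n - 1]\<close>; a general
  \<open>\<epsilon>\<close> is the tail placed below it.\<close>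

definition descend :: "nat list \<Rightarrow> nat \<Rightarrow> nat \<Rightarrow> nat \<Rightarrow> coeff \<Rightarrow> coeff" where
  "descend L n k d \<epsilon> = (\<lambda>j. if j < k then \<epsilon> j else if j = k then d else theta L n j)"

text \<open>Block decompositions read from the top. The bound \<open>n\<close> is exclusive and each
  block ends exactly one place below the current bound, so the support intervals leave no gaps. Rule
  induction then replaces the handling of sets of blocks.\<close>

inductive zeck_below :: "nat list \<Rightarrow> nat \<Rightarrow> coeff \<Rightarrow> bool" for L where
  zero: "zeck_below L 1 (\<lambda>_. 0)"
| maximal: "n \<ge> 2 \<Longrightarrow> zeck_below L n (theta L n)"
| proper: "1 \<le> k \<Longrightarrow> k < n \<Longrightarrow> d < theta L n k \<Longrightarrow> zeck_below L k \<epsilon> \<Longrightarrow>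
    zeck_below L n (descend L n k d \<epsilon>)"

lemma theta_eq_0: "j = 0 \<or> n \<le> j \<Longrightarrow> theta L n j = 0"
  by (auto simp: theta_def rev_coeff_def)

lemma theta_top_pos:
  assumes "zeck_list L" "n \<ge> 1"
  shows "theta L (Suc n) n > 0"
  using assms by (auto simp: theta_def rev_coeff_def beta_star_def zeck_list_def)

lemma zeck_below_support:
  assumes "zeck_below L n \<epsilon>"
  shows "n \<ge> 1" "\<epsilon> 0 = 0" "\<And>j. n \<le> j \<Longrightarrow> \<epsilon> j = 0"
  using assms by (induction) (auto simp: theta_eq_0 descend_def)

text \<open>The first list entry is nonzero, so the digit 0 at \<open>n\<close> is smaller than
  \<open>theta L (Suc n) n\<close> and forms a proper block on \<open>[n, n]\<close>. Such zero
  blocks fill the gaps that a disjoint family may have.\<close>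

lemma zeck_below_Suc:
  assumes "zeck_list L" "zeck_below L n \<epsilon>"
  shows "zeck_below L (Suc n) \<epsilon>"
proof -
  note supp = zeck_below_support[OF assms(2)]
  have "\<epsilon> = descend L (Suc n) n 0 \<epsilon>"
    using supp by (auto simp: descend_def theta_eq_0 fun_eq_iff)
  moreover have "zeck_below L (Suc n) (descend L (Suc n) n 0 \<epsilon>)"
    using supp theta_top_pos[OF assms(1)] assms(2) by (intro zeck_below.proper) auto
  ultimately show ?thesis by simp
qed

lemma zeck_below_mono:
  assumes "zeck_list L" "zeck_below L n \<epsilon>" "n \<le> m"
  shows "zeck_below L m \<epsilon>"
  using assms(3,2) by (induction rule: dec_induct) (auto intro: zeck_below_Suc[OF assms(1)])

section \<open>Disjoint families of blocks versus the recursive form\<close>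

text \<open>The bound on the right ends serves as induction parameter; finiteness provides one for
  every family.\<close>

definition block_family :: "nat list \<Rightarrow> nat \<Rightarrow> (coeff \<times> nat \<times> nat) set \<Rightarrow> bool" where
  "block_family L n B \<longleftrightarrow> finite B \<and> (\<forall>(\<zeta>, a, b)\<in>B. L_block L \<zeta> a b \<and> b < n) \<and>
     disjoint_family_on (\<lambda>(\<zeta>, a, b). {a..b}) B"

lemma zeck_collection_iff_block_family:
  "\<epsilon> \<in> zeck_collection L \<longleftrightarrow> (\<exists>n B. block_family L n B \<and> \<epsilon> = (\<lambda>j. \<Sum>(\<zeta>, a, b)\<in>B. \<zeta> j))"
proof
  assume "\<epsilon> \<in> zeck_collection L"
  then obtain B where B: "finite B" "\<forall>(\<zeta>, a, b)\<in>B. L_block L \<zeta> a b"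
    "disjoint_family_on (\<lambda>(\<zeta>, a, b). {a..b}) B" "\<epsilon> = (\<lambda>j. \<Sum>(\<zeta>, a, b)\<in>B. \<zeta> j)"
    unfolding zeck_collection_def by auto
  have "finite ((\<lambda>(\<zeta>, a, b). b) ` B)" using B(1) by simp
  then obtain n where n: "\<forall>i\<in>(\<lambda>(\<zeta>, a, b). b) ` B. i < n"
    using finite_nat_set_iff_bounded by blast
  have "block_family L n B"
    unfolding block_family_def using B n by fastforce
  with B(4) show "\<exists>n B. block_family L n B \<and> \<epsilon> = (\<lambda>j. \<Sum>(\<zeta>, a, b)\<in>B. \<zeta> j)" by blast
next
  assume "\<exists>n B. block_family L n B \<and> \<epsilon> = (\<lambda>j. \<Sum>(\<zeta>, a, b)\<in>B. \<zeta> j)"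
  then show "\<epsilon> \<in> zeck_collection L"
    unfolding zeck_collection_def block_family_def by fast
qed

lemma L_block_support:
  assumes "L_block L \<zeta> a b"
  shows "1 \<le> a" "a \<le> b" "\<And>j. j < a \<or> b < j \<Longrightarrow> \<zeta> j = 0"
  using assms unfolding L_block_def maximal_block_def proper_block_def
  by (auto simp: theta_eq_0)

lemma L_block_cases:
  assumes "L_block L \<zeta> a b"
  obtains "\<zeta> = theta L (Suc b)" "a = 1"
  | "\<zeta> a < theta L (Suc b) a" "\<zeta> = descend L (Suc b) a (\<zeta> a) (\<lambda>_. 0)"
proof -
  consider "maximal_block L \<zeta> a b" | "proper_block L \<zeta> a b"
    using assms unfolding L_block_def by blast
  then show thesis
  proof cases
    case 1
    then show thesis using that(1) by (auto simp: maximal_block_def)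
  next
    case 2
    then obtain n where "n \<ge> 2" "b = n - 1" "\<forall>j>a. \<zeta> j = theta L n j" "\<zeta> a < theta L n a"
      "\<forall>j<a. \<zeta> j = 0"
      unfolding proper_block_def by blast
    then show thesis using that(2) by (auto simp: descend_def fun_eq_iff)
  qed
qed

lemma L_block_theta: "n \<ge> 2 \<Longrightarrow> L_block L (theta L n) 1 (n - 1)"
  unfolding L_block_def maximal_block_def by blast

lemma L_block_descend:
  assumes "1 \<le> k" "k < n" "d < theta L n k"
  shows "L_block L (descend L n k d (\<lambda>_. 0)) k (n - 1)"
  unfolding L_block_def proper_block_def
  by (rule disjI2, rule exI[of _ n]) (use assms in \<open>auto simp: descend_def\<close>)

lemma block_family_sum_support:
  assumes "block_family L n B" "n \<le> j"
  shows "(\<Sum>(\<zeta>, a, b)\<in>B. \<zeta> j) = 0"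
proof (intro sum.neutral ballI, clarify)
  fix \<zeta> a b assume "(\<zeta>, a, b) \<in> B"
  then have "L_block L \<zeta> a b" "b < n" using assms by (auto simp: block_family_def)
  then show "\<zeta> j = 0" using L_block_support(3)[of L \<zeta> a b j] assms(2) by simp
qed

text \<open>A descent adds one block on \<open>[k, n - 1]\<close> to the family of its tail, whose
  right ends all lie below \<open>k\<close>.\<close>

lemma zeck_below_block_family:
  assumes "zeck_below L n \<epsilon>"
  shows "\<exists>B. block_family L n B \<and> \<epsilon> = (\<lambda>j. \<Sum>(\<zeta>, a, b)\<in>B. \<zeta> j)"
  using assms
proof induction
  case zero
  show ?case
    by (rule exI[of _ "{}"]) (simp add: block_family_def disjoint_family_on_def)
next
  case (maximal n)
  then show ?case
    using L_block_theta[of n L]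
    by (intro exI[of _ "{(theta L n, 1, n - 1)}"])
       (simp add: block_family_def disjoint_family_on_def)
next
  case (proper k n d \<epsilon>)
  then obtain B where B: "block_family L k B" "\<epsilon> = (\<lambda>j. \<Sum>(\<zeta>, a, b)\<in>B. \<zeta> j)" by blast
  let ?\<zeta> = "descend L n k d (\<lambda>_. 0)"
  let ?C = "insert (?\<zeta>, k, n - 1) B"
  have new: "(?\<zeta>, k, n - 1) \<notin> B"
    using B(1) proper by (auto simp: block_family_def)
  have fin: "finite B" using B(1) by (simp add: block_family_def)
  have "block_family L n ?C"
    unfolding block_family_def
  proof (intro conjI)
    show "disjoint_family_on (\<lambda>(\<zeta>, a, b). {a..b}) ?C"
      unfolding disjoint_family_on_insert[OF new]
      using B(1) by (auto simp: block_family_def)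
    show "\<forall>(\<zeta>, a, b)\<in>?C. L_block L \<zeta> a b \<and> b < n"
      using B(1) proper L_block_descend[of k n d L] by (auto simp: block_family_def)
  qed (simp add: fin)
  moreover have "descend L n k d \<epsilon> = (\<lambda>j. \<Sum>(\<zeta>, a, b)\<in>?C. \<zeta> j)"
  proof
    fix j
    show "descend L n k d \<epsilon> j = (\<Sum>(\<zeta>, a, b)\<in>?C. \<zeta> j)"
      using new fin B(2) block_family_sum_support[OF B(1), of j]
      by (auto simp: descend_def not_less)
  qed
  ultimately show ?case by blast
qed

text \<open>The topmost block is peeled off. If no block ends at \<open>n - 1\<close>, the bound is
  lowered by one. Otherwise the block ending there starts at some \<open>a\<close>, all others end
  below \<open>a\<close>, and the induction hypothesis at \<open>a\<close> makes their sum the tail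
  of a descent.\<close>

lemma block_family_zeck_below:
  assumes "zeck_list L" "n \<ge> 1" "block_family L n B"
  shows "zeck_below L n (\<lambda>j. \<Sum>(\<zeta>, a, b)\<in>B. \<zeta> j)"
  using assms(2,3)
proof (induction n arbitrary: B rule: less_induct)
  case (less n)
  note B = less.prems(2)
  have fin: "finite B" using B by (simp add: block_family_def)
  show ?case
  proof (cases "\<exists>\<zeta> a. (\<zeta>, a, n - 1) \<in> B")
    case False
    show ?thesis
    proof (cases "n = 1")
      case True
      \<comment> \<open>A nonempty interval of positive indices cannot end before 1.\<close>
      then have "B = {}"
        using B L_block_support(1,2)[of L] by (fastforce simp: block_family_def)
      with True show ?thesis using zeck_below.zero[of L] by simp
    next
      case n1: False
      have "b < n - 1" if "(\<zeta>, a, b) \<in> B" for \<zeta> a b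
      proof -
        have "b < n" using that B by (auto simp: block_family_def)
        moreover have "b \<noteq> n - 1" using that False by blast
        ultimately show ?thesis by linarith
      qed
      then have "block_family L (n - 1) B"
        using B by (fastforce simp: block_family_def)
      then have "zeck_below L (n - 1) (\<lambda>j. \<Sum>(\<zeta>, a, b)\<in>B. \<zeta> j)"
        using n1 less.prems(1) by (intro less.IH) auto
      then show ?thesis by (rule zeck_below_mono[OF assms(1)]) simp
    qed
  next
    case True
    then obtain \<zeta> a where top: "(\<zeta>, a, n - 1) \<in> B" by blast
    then have block: "L_block L \<zeta> a (n - 1)" using B by (auto simp: block_family_def)
    note supp = L_block_support[OF block]
    have n: "n \<ge> 2" "a < n" using supp by auto
    define C where "C = B - {(\<zeta>, a, n - 1)}"
    have sum: "(\<Sum>(\<zeta>, a, b)\<in>B. \<zeta> j) = \<zeta> j + (\<Sum>(\<zeta>, a, b)\<in>C. \<zeta> j)" for j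
      unfolding C_def using sum.remove[OF fin top, of "\<lambda>(\<zeta>, a, b). \<zeta> j"] by simp
    have below: "1 \<le> b \<and> b < a" if "(\<zeta>', a', b) \<in> C" for \<zeta>' a' b
    proof -
      have "{a'..b} \<inter> {a..n - 1} = {}"
        using that top B unfolding block_family_def disjoint_family_on_def C_def by blast
      \<comment> \<open>Since \<open>a' \<le> b\<close>, the index \<open>b\<close> lies in its own
        interval, hence outside \<open>{a..n - 1}\<close>; with \<open>b < n\<close> only
        \<open>b < a\<close> remains.\<close>
      then have "b \<notin> {a'..b} \<inter> {a..n - 1}" by simp
      moreover have "L_block L \<zeta>' a' b" "b < n"
        using that B by (auto simp: block_family_def C_def)
      note L_block_support(1,2)[OF this(1)] this(2)
      ultimately show ?thesis by auto
    qed
    have C: "block_family L a C"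
      unfolding block_family_def
    proof (intro conjI)
      show "disjoint_family_on (\<lambda>(\<zeta>, a, b). {a..b}) C"
        using B unfolding block_family_def C_def
        by (auto elim: disjoint_family_on_mono[rotated])
      show "\<forall>(\<zeta>, a', b)\<in>C. L_block L \<zeta> a' b \<and> b < a"
        using B below by (auto simp: C_def block_family_def)
    qed (simp add: fin C_def)
    from block show ?thesis
    proof (cases rule: L_block_cases)
      case 1
      \<comment> \<open>A maximal block reaches down to 1, so nothing fits below it.\<close>
      then have "C = {}" using below by fastforce
      then have "(\<lambda>j. \<Sum>(\<zeta>, a, b)\<in>B. \<zeta> j) = theta L n"
        using sum 1 n by simp
      then show ?thesis using zeck_below.maximal[OF n(1), of L] by (simp only:)
    next
      case 2
      have "zeck_below L a (\<lambda>j. \<Sum>(\<zeta>, a, b)\<in>C. \<zeta> j)"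
        using less.IH[OF n(2) supp(1) C] .
      then have "zeck_below L n (descend L n a (\<zeta> a) (\<lambda>j. \<Sum>(\<zeta>, a, b)\<in>C. \<zeta> j))"
        using zeck_below.proper[OF supp(1) n(2)] 2(1) n by simp
      moreover have "descend L n a (\<zeta> a) (\<lambda>j. \<Sum>(\<zeta>, a, b)\<in>C. \<zeta> j) =
        (\<lambda>j. \<Sum>(\<zeta>, a, b)\<in>B. \<zeta> j)"
      proof
        fix j
        have "\<zeta> j = (if j < a then 0 else if j = a then \<zeta> a else theta L n j)"
          using fun_cong[OF 2(2), of j] n by (simp add: descend_def)
        then show "descend L n a (\<zeta> a) (\<lambda>j. \<Sum>(\<zeta>, a, b)\<in>C. \<zeta> j) j = (\<Sum>(\<zeta>, a, b)\<in>B. \<zeta> j)"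
          unfolding sum using block_family_sum_support[OF C, of j]
          by (auto simp: descend_def not_less)
      qed
      ultimately show ?thesis by (simp only:)
    qed
  qed
qed

lemma zeck_collection_iff_below:
  assumes "zeck_list L"
  shows "\<epsilon> \<in> zeck_collection L \<longleftrightarrow> (\<exists>n. zeck_below L n \<epsilon>)"
proof
  assume "\<epsilon> \<in> zeck_collection L"
  then obtain n B where B: "block_family L n B" "\<epsilon> = (\<lambda>j. \<Sum>(\<zeta>, a, b)\<in>B. \<zeta> j)"
    by (auto simp: zeck_collection_iff_block_family)
  \<comment> \<open>The bound is raised because \<open>zeck_below\<close> starts at 1, while
    \<open>n\<close> may be 0.\<close>
  then have "block_family L (Suc n) B" by (fastforce simp: block_family_def)
  from block_family_zeck_below[OF assms _ this] B(2)
  show "\<exists>n. zeck_below L n \<epsilon>" by auto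
next
  assume "\<exists>n. zeck_below L n \<epsilon>"
  then show "\<epsilon> \<in> zeck_collection L"
    unfolding zeck_collection_iff_block_family using zeck_below_block_family by blast
qed

section \<open>Evaluation of descents and the fundamental sequence\<close>

lemma csum_eq_sum_below:
  assumes "\<And>j. n \<le> j \<Longrightarrow> \<mu> j = 0"
  shows "csum \<mu> G = (\<Sum>k = 1..<n. \<mu> k * G k)"
  unfolding csum_def
proof (rule sum.mono_neutral_left)
  show "{k. 1 \<le> k \<and> \<mu> k \<noteq> 0} \<subseteq> {1..<n}"
    using assms by (auto, metis less_irrefl not_le)
qed auto

lemma fund_seq_eq:
  assumes "n \<ge> 2"
  shows "fund_seq L n = 1 + (\<Sum>k = 1..<n. theta L n k * fund_seq L k)"
  using assms by (simp add: fund_seq.simps[of L n])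

text \<open>The positive top digit of \<open>theta L (Suc n)\<close> contributes at least
  \<open>fund_seq L n\<close>, and the recursion adds 1. The resulting unboundedness is what lets
  evaluation reach every integer.\<close>

lemma fund_seq_ge:
  assumes "zeck_list L"
  shows "n \<le> fund_seq L n"
proof (induction n)
  case (Suc n)
  show ?case
  proof (cases "n = 0")
    case True
    then show ?thesis using fund_seq_1[of L] by simp
  next
    case False
    then have "fund_seq L n \<le> theta L (Suc n) n * fund_seq L n"
      using theta_top_pos[OF assms, of n] by simp
    also have "\<dots> \<le> (\<Sum>k = 1..<Suc n. theta L (Suc n) k * fund_seq L k)"
      using False by (intro member_le_sum) auto
    finally show ?thesis using Suc fund_seq_eq[of "Suc n" L] False by simp
  qed
qed simp

lemma csum_descend:
  assumes "1 \<le> k" "k < n" "\<And>j. k \<le> j \<Longrightarrow> \<epsilon> j = 0"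
  shows "csum (descend L n k d \<epsilon>) G =
    csum \<epsilon> G + d * G k + (\<Sum>j = Suc k..<n. theta L n j * G j)"
proof -
  let ?f = "\<lambda>j. descend L n k d \<epsilon> j * G j"
  have "csum (descend L n k d \<epsilon>) G = sum ?f {1..<n}"
    using assms by (intro csum_eq_sum_below) (auto simp: descend_def theta_eq_0)
  also have "\<dots> = sum ?f {1..<k} + sum ?f {k..<n}"
    using assms by (simp add: sum.atLeastLessThan_concat)
  also have "sum ?f {k..<n} = ?f k + sum ?f {Suc k..<n}"
    using assms by (simp add: sum.atLeast_Suc_lessThan)
  also have "sum ?f {Suc k..<n} = (\<Sum>j = Suc k..<n. theta L n j * G j)"
    by (intro sum.cong) (auto simp: descend_def)
  also have "sum ?f {1..<k} = csum \<epsilon> G"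
    by (subst csum_eq_sum_below[of k \<epsilon>]) (auto simp: assms(3) descend_def intro!: sum.cong)
  finally show ?thesis by (simp add: descend_def)
qed

lemma csum_theta: "csum (theta L n) G = (\<Sum>j = 1..<n. theta L n j * G j)"
  by (intro csum_eq_sum_below) (simp add: theta_eq_0)

text \<open>The tail is worth less than one unit of the digit at \<open>k\<close>, so the smaller
  digit there decides whatever \<open>\<mu>\<close> does below \<open>k\<close>. Keeping
  \<open>\<mu>\<close> general covers comparison with the maximal block and with other
  descents.\<close>

lemma csum_descend_less:
  assumes "1 \<le> k" "k < n" "\<And>j. k \<le> j \<Longrightarrow> \<epsilon> j = 0" "csum \<epsilon> G < G k"
    and "d < \<mu> k" "\<And>j. k < j \<Longrightarrow> \<mu> j = theta L n j"
  shows "csum (descend L n k d \<epsilon>) G < csum \<mu> G"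
proof -
  have eq: "csum \<mu> G = (\<Sum>j = 1..<k. \<mu> j * G j) + (\<mu> k * G k + (\<Sum>j = Suc k..<n. theta L n j * G j))"
  proof -
    have "csum \<mu> G = (\<Sum>j = 1..<n. \<mu> j * G j)"
      using assms by (intro csum_eq_sum_below) (simp add: theta_eq_0)
    also have "\<dots> = (\<Sum>j = 1..<k. \<mu> j * G j) + (\<Sum>j = k..<n. \<mu> j * G j)"
      using assms by (simp add: sum.atLeastLessThan_concat)
    also have "(\<Sum>j = k..<n. \<mu> j * G j) = \<mu> k * G k + (\<Sum>j = Suc k..<n. \<mu> j * G j)"
      using assms by (simp add: sum.atLeast_Suc_lessThan)
    also have "(\<Sum>j = Suc k..<n. \<mu> j * G j) = (\<Sum>j = Suc k..<n. theta L n j * G j)"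
      using assms(6) by (intro sum.cong) auto
    finally show ?thesis .
  qed
  have "csum \<epsilon> G + d * G k < Suc d * G k" using assms(4) by simp
  also have "\<dots> \<le> \<mu> k * G k" using assms(5) by (intro mult_le_mono1) simp
  finally show ?thesis
    unfolding eq using csum_descend[OF assms(1-3), where L = L and d = d and G = G] by simp
qed

text \<open>By the recursion the maximal block has value \<open>fund_seq L n - 1\<close>, and every
  descent is worth less; the induction hypothesis is the tail bound needed for that
  comparison.\<close>

lemma zeck_below_csum_less:
  assumes "zeck_below L n \<epsilon>"
  shows "csum \<epsilon> (fund_seq L) < fund_seq L n"
  using assms
proof induction
  case zero
  show ?case by (simp add: csum_def fund_seq_1[simplified])
next
  case (maximal n)
  then show ?case by (simp add: fund_seq_rec)
next
  case (proper k n d \<epsilon>)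
  have "csum (descend L n k d \<epsilon>) (fund_seq L) < csum (theta L n) (fund_seq L)"
    using proper zeck_below_support(3)[OF proper(4)] by (intro csum_descend_less) auto
  then show ?case using proper fund_seq_rec[of n L] by simp
qed

section \<open>The order and strict monotonicity of evaluation\<close>

lemma less_a_asym: "\<mu> <\<^sub>a \<nu> \<Longrightarrow> \<not> \<nu> <\<^sub>a \<mu>"
  unfolding less_a_def by (metis less_asym linorder_neqE_nat)

lemma less_a_irrefl: "\<not> \<mu> <\<^sub>a \<mu>"
  by (simp add: less_a_def)

lemma less_aI: "\<mu> k < \<nu> k \<Longrightarrow> (\<And>j. k < j \<Longrightarrow> \<mu> j = \<nu> j) \<Longrightarrow> \<mu> <\<^sub>a \<nu>"
  unfolding less_a_def by (intro exI[of _ k]) auto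

text \<open>A common bound on the supports makes the set of disagreements finite, and its maximum
  decides.\<close>

lemma less_a_total:
  assumes "\<And>j. n \<le> j \<Longrightarrow> \<mu> j = 0" "\<And>j. n \<le> j \<Longrightarrow> \<nu> j = 0" "\<mu> \<noteq> \<nu>"
  shows "\<mu> <\<^sub>a \<nu> \<or> \<nu> <\<^sub>a \<mu>"
proof -
  let ?D = "{j. \<mu> j \<noteq> \<nu> j}"
  have sub: "?D \<subseteq> {..<n}"
  proof
    fix j assume "j \<in> ?D"
    then show "j \<in> {..<n}" using assms(1,2)[of j] by (cases "n \<le> j") auto
  qed
  then have fin: "finite ?D" by (rule finite_subset) simp
  have "?D \<noteq> {}" using assms(3) by auto
  define k where "k = Max ?D"
  have k: "\<mu> k \<noteq> \<nu> k" using Max_in[OF fin \<open>?D \<noteq> {}\<close>] by (simp add: k_def)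
  have "\<mu> j = \<nu> j" if "k < j" for j
    using Max_ge[OF fin, of j] that by (auto simp: k_def)
  with k show ?thesis by (metis less_aI nat_neq_iff)
qed

text \<open>Two elements are compared by the places \<open>k\<close> and \<open>l\<close> where they
  leave the maximal block: the one leaving at the higher place is smaller. At equal places the
  digits decide, and at equal digits the tails do.\<close>

lemma zeck_below_csum_strict_mono:
  assumes "zeck_below L n \<epsilon>" "zeck_below L n \<delta>" "\<epsilon> <\<^sub>a \<delta>"
  shows "csum \<epsilon> (fund_seq L) < csum \<delta> (fund_seq L)"
  using assms
proof (induction arbitrary: \<delta>)
  case zero
  then have "\<delta> = (\<lambda>_. 0)"
    using zeck_below_support(2,3)[OF zero(1)] by (metis One_nat_def less_one not_less)
  with zero show ?case by (simp add: less_a_def)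
next
  case (maximal n)
  from maximal(2) show ?case
  proof cases
    case (proper l f \<delta>')
    \<comment> \<open>A descent lies below the maximal block, so this case contradicts the assumed
      order.\<close>
    then have "\<delta> <\<^sub>a theta L n" by (intro less_aI[of _ l]) (auto simp: descend_def)
    with maximal(3) show ?thesis by (simp add: less_a_asym)
  qed (use maximal less_a_irrefl in auto)
next
  case (proper k n d \<epsilon>)
  let ?\<epsilon> = "descend L n k d \<epsilon>"
  note supp = zeck_below_support(3)[OF proper(4)]
  note lt = csum_descend_less[OF proper(1,2) supp zeck_below_csum_less[OF proper(4)]]
  from proper(6) show ?case
  proof cases
    case zero
    then show ?thesis using proper by simp
  next
    case maximal
    then show ?thesis using lt proper(3) by simp
  next
    case (proper l f \<delta>')
    note supp' = zeck_below_support(3)[OF proper(5)]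
    consider "l < k" | "k < l" | "l = k" by linarith
    then show ?thesis
    proof cases
      case 1
      then show ?thesis
        using lt[of d \<delta>] \<open>d < theta L n k\<close> by (simp add: proper descend_def)
    next
      case 2
      \<comment> \<open>At \<open>l\<close> the first element still follows
        \<open>theta L n\<close>, while \<open>\<delta>\<close> has already dropped below
        it.\<close>
      then have "\<delta> <\<^sub>a ?\<epsilon>"
        using proper by (intro less_aI[of _ l]) (auto simp: descend_def)
      with \<open>?\<epsilon> <\<^sub>a \<delta>\<close> show ?thesis by (simp add: less_a_asym)
    next
      case 3
      consider "d < f" | "f < d" | "d = f" by linarith
      then show ?thesis
      proof cases
        case 1
        then show ?thesis using lt[of d \<delta>] 3 by (simp add: proper descend_def)
      next
        case 2
        then have "\<delta> <\<^sub>a ?\<epsilon>"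
          using proper 3 by (intro less_aI[of _ k]) (auto simp: descend_def)
        with \<open>?\<epsilon> <\<^sub>a \<delta>\<close> show ?thesis by (simp add: less_a_asym)
      next
        case df: 3
        obtain i where i: "?\<epsilon> i < \<delta> i" "\<And>j. i < j \<Longrightarrow> ?\<epsilon> j = \<delta> j"
          using \<open>?\<epsilon> <\<^sub>a \<delta>\<close> unfolding less_a_def by blast
        \<comment> \<open>Both descents agree from \<open>k\<close> upwards, so the deciding index
          lies in the tails and witnesses their order too.\<close>
        have "i < k" using i(1) 3 df by (auto simp: proper descend_def split: if_splits)
        have "\<epsilon> <\<^sub>a \<delta>'"
        proof (rule less_aI[of _ i])
          show "\<epsilon> i < \<delta>' i" using i(1) \<open>i < k\<close> 3 by (simp add: proper descend_def)
          show "\<epsilon> j = \<delta>' j" if "i < j" for j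
            using i(2)[OF that] 3 supp[of j] supp'[of j]
            by (cases "j < k") (auto simp: proper descend_def)
        qed
        then have "csum \<epsilon> (fund_seq L) < csum \<delta>' (fund_seq L)"
          using "proper.IH"[of \<delta>'] proper(5) 3 by simp
        then show ?thesis
          using 3 df csum_descend[OF proper(2,3) supp'] csum_descend[OF \<open>1 \<le> k\<close> \<open>k < n\<close> supp]
          by (simp add: proper(1))
      qed
    qed
  qed
qed

section \<open>Surjectivity of evaluation\<close>

text \<open>Greedy expansion: the digits of \<open>theta L n\<close> are followed from the top as
  long as their total does not exceed \<open>m\<close>; division with remainder at the next place
  gives the digit and the value of the tail.\<close>

lemma zeck_below_csum_surj:
  assumes "n \<ge> 1" "m < fund_seq L n"
  shows "\<exists>\<epsilon>. zeck_below L n \<epsilon> \<and> csum \<epsilon> (fund_seq L) = m"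
  using assms
proof (induction n arbitrary: m rule: less_induct)
  case (less n)
  let ?H = "fund_seq L"
  define T where "T k = (\<Sum>j = k..<n. theta L n j * ?H j)" for k
  have "m \<le> T 1" if "n \<ge> 2"
    using less.prems(2) fund_seq_eq[OF that, of L] by (simp add: T_def)
  then consider "n = 1" | "n \<ge> 2" "m = T 1" | "n \<ge> 2" "m < T 1"
    using less.prems(1) by (cases "n = 1"; cases "m = T 1") auto
  then show ?case
  proof cases
    case 1
    then show ?thesis
      using less.prems zeck_below.zero[of L] by (auto simp: fund_seq_1[simplified] csum_def)
  next
    case 2
    then show ?thesis
      using zeck_below.maximal[of n L] csum_theta[of L n ?H] by (auto simp: T_def)
  next
    case 3
    \<comment> \<open>\<open>T k\<close> is the value of the maximal block from place
      \<open>k\<close> upwards. As \<open>T n = 0\<close> and \<open>T 0 = T 1 > m\<close>, the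
      least index with \<open>T k' \<le> m\<close> is at least 2; the departure place is its
      predecessor \<open>k\<close>, where \<open>T (Suc k) \<le> m < T k\<close>.\<close>
    define k' where "k' = (LEAST k. T k \<le> m)"
    have Tn: "T n \<le> m" by (simp add: T_def)
    have k': "T k' \<le> m" unfolding k'_def by (rule LeastI[of _ n]) (rule Tn)
    have "k' \<le> n" unfolding k'_def by (rule Least_le) (rule Tn)
    have "T 0 = T 1" unfolding T_def using 3
      by (subst sum.atLeast_Suc_lessThan) (auto simp: theta_eq_0)
    then have "k' \<noteq> 0" "k' \<noteq> 1" using k' 3 by (metis not_le)+
    then obtain k where k: "k' = Suc k" "1 \<le> k" by (cases k') auto
    then have kn: "k < n" using \<open>k' \<le> n\<close> by simp
    have "m < T k" using not_less_Least[of k "\<lambda>k. T k \<le> m"] k by (simp add: k'_def[symmetric])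
    moreover have "T k = theta L n k * ?H k + T (Suc k)"
      unfolding T_def using kn by (simp add: sum.atLeast_Suc_lessThan)
    \<comment> \<open>This bound makes the quotient by \<open>?H k\<close> an admissible digit,
      smaller than \<open>theta L n k\<close>.\<close>
    ultimately have r: "m - T (Suc k) < theta L n k * ?H k" using k' k by simp
    then have pos: "?H k > 0" by (cases "?H k") auto
    obtain \<epsilon> where \<epsilon>: "zeck_below L k \<epsilon>" "csum \<epsilon> ?H = (m - T (Suc k)) mod ?H k"
      using less.IH[OF kn k(2), of "(m - T (Suc k)) mod ?H k"] pos by auto
    let ?d = "(m - T (Suc k)) div ?H k"
    have "?d < theta L n k" using r by (simp add: less_mult_imp_div_less)
    then have "zeck_below L n (descend L n k ?d \<epsilon>)"
      using k kn \<epsilon> by (intro zeck_below.proper)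
    moreover have "csum (descend L n k ?d \<epsilon>) ?H = m"
    proof -
      have "csum (descend L n k ?d \<epsilon>) ?H = (m - T (Suc k)) mod ?H k + ?d * ?H k + T (Suc k)"
        unfolding T_def \<epsilon>(2)[unfolded T_def, symmetric]
        by (rule csum_descend[OF k(2) kn zeck_below_support(3)[OF \<epsilon>(1)]])
      also have "\<dots> = (m - T (Suc k)) + T (Suc k)" by (simp only: mod_div_mult_eq)
      also have "\<dots> = m" using k' k by simp
      finally show ?thesis .
    qed
    ultimately show ?thesis by blast
  qed
qed

section \<open>The order isomorphism on the whole collection\<close>

lemma zeck_collection_common_bound:
  assumes "zeck_list L" "\<epsilon> \<in> zeck_collection L" "\<delta> \<in> zeck_collection L"
  obtains n where "zeck_below L n \<epsilon>" "zeck_below L n \<delta>"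
proof -
  obtain m n where "zeck_below L m \<epsilon>" "zeck_below L n \<delta>"
    using assms by (auto simp: zeck_collection_iff_below)
  then have "zeck_below L (max m n) \<epsilon>" "zeck_below L (max m n) \<delta>"
    using zeck_below_mono[OF assms(1)] by (meson max.cobounded1 max.cobounded2)+
  then show thesis by (rule that)
qed

lemma zeck_collection_less_a_total:
  assumes "zeck_list L" "\<epsilon> \<in> zeck_collection L" "\<delta> \<in> zeck_collection L" "\<epsilon> \<noteq> \<delta>"
  shows "\<epsilon> <\<^sub>a \<delta> \<or> \<delta> <\<^sub>a \<epsilon>"
proof -
  obtain n where "zeck_below L n \<epsilon>" "zeck_below L n \<delta>"
    using zeck_collection_common_bound[OF assms(1-3)] .
  with assms(4) show ?thesis by (intro less_a_total[of n]) (auto dest: zeck_below_support(3))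
qed

lemma zeck_collection_less_a_iff:
  assumes "zeck_list L" "\<epsilon> \<in> zeck_collection L" "\<delta> \<in> zeck_collection L"
  shows "\<epsilon> <\<^sub>a \<delta> \<longleftrightarrow> csum \<epsilon> (fund_seq L) < csum \<delta> (fund_seq L)"
proof -
  obtain n where "zeck_below L n \<epsilon>" "zeck_below L n \<delta>"
    using zeck_collection_common_bound[OF assms] .
  then show ?thesis
    using zeck_below_csum_strict_mono zeck_collection_less_a_total[OF assms]
    by (metis less_asym less_irrefl)
qed

lemma zeck_collection_csum_bij:
  assumes "zeck_list L"
  shows "bij_betw (\<lambda>\<epsilon>. csum \<epsilon> (fund_seq L)) (zeck_collection L) UNIV"
proof (rule bij_betwI')
  fix \<epsilon> \<delta> assume "\<epsilon> \<in> zeck_collection L" "\<delta> \<in> zeck_collection L"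
  then show "csum \<epsilon> (fund_seq L) = csum \<delta> (fund_seq L) \<longleftrightarrow> \<epsilon> = \<delta>"
    using zeck_collection_less_a_total[OF assms, of \<epsilon> \<delta>]
      zeck_collection_less_a_iff[OF assms, of \<epsilon> \<delta>] zeck_collection_less_a_iff[OF assms, of \<delta> \<epsilon>]
    by auto
next
  fix m :: nat
  have "m < fund_seq L (Suc m)" using fund_seq_ge[OF assms, of "Suc m"] by simp
  then obtain \<epsilon> where "zeck_below L (Suc m) \<epsilon>" "csum \<epsilon> (fund_seq L) = m"
    using zeck_below_csum_surj[of "Suc m" m L] by auto
  then show "\<exists>\<epsilon>\<in>zeck_collection L. m = csum \<epsilon> (fund_seq L)"
    using zeck_collection_iff_below[OF assms] by blast
qed simp

section \<open>Counting the elements below \<open>\<mu>\<close>\<close>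

theorem theorem3p9:
  fixes L L' :: "nat list" and \<mu> :: coeff
  assumes "zeck_list L" and "zeck_list L'"
    and "zeck_collection L \<subset> zeck_collection L'"
    and "\<mu> \<in> zeck_collection L'" and "\<mu> \<noteq> (\<lambda>_. 0)"
  shows "z_count L L' (csum \<mu> (fund_seq L')) =
         csum (bar_coeff (zeck_collection L) \<mu>) (fund_seq L)"
proof -
  let ?E = "zeck_collection L"
  define f where "f = (\<lambda>\<epsilon>. csum \<epsilon> (fund_seq L))"
  define f' where "f' = (\<lambda>\<epsilon>. csum \<epsilon> (fund_seq L'))"
  have bij: "bij_betw f ?E UNIV"
    unfolding f_def using zeck_collection_csum_bij[OF assms(1)] .
  have surj: "f ` ?E = UNIV" using bij by (rule bij_betw_imp_surj_on)
  have inj: "inj_on f ?E" using bij by (rule bij_betw_imp_inj_on)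
  have inj': "inj_on f' (zeck_collection L')"
    unfolding f'_def using bij_betw_imp_inj_on[OF zeck_collection_csum_bij[OF assms(2)]] .
  have less: "\<epsilon> <\<^sub>a \<delta> \<longleftrightarrow> f \<epsilon> < f \<delta>" if "\<epsilon> \<in> ?E" "\<delta> \<in> ?E" for \<epsilon> \<delta>
    using zeck_collection_less_a_iff[OF assms(1) that] by (simp add: f_def)
  have less': "\<epsilon> <\<^sub>a \<delta> \<longleftrightarrow> f' \<epsilon> < f' \<delta>"
    if "\<epsilon> \<in> zeck_collection L'" "\<delta> \<in> zeck_collection L'" for \<epsilon> \<delta>
    using zeck_collection_less_a_iff[OF assms(2) that] by (simp add: f'_def)
  have eq: "\<epsilon> = \<delta> \<longleftrightarrow> f \<epsilon> = f \<delta>" if "\<epsilon> \<in> ?E" "\<delta> \<in> ?E" for \<epsilon> \<delta>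
    using inj that by (auto dest: inj_onD)
  have sub: "\<epsilon> \<in> zeck_collection L'" if "\<epsilon> \<in> ?E" for \<epsilon> using that assms(3) by blast
  define S where "S = {\<epsilon> \<in> ?E. \<epsilon> <\<^sub>a \<mu>}"
  have injS: "inj_on f' S" using inj' sub by (auto simp: S_def inj_on_def)
  \<comment> \<open>Evaluation by \<open>f'\<close> is injective and respects the order on the
    larger collection, so the counted integers correspond to the elements of
    \<open>S\<close>.\<close>
  have count: "z_count L L' (f' \<mu>) = card S"
  proof -
    have "{n. n < f' \<mu> \<and> (\<exists>\<epsilon>\<in>?E. n = f' \<epsilon>)} = f' ` S"
      using less' sub assms(4) by (auto simp: S_def)
    then show ?thesis using card_image[OF injS] by (simp add: z_count_def f'_def)
  qed
  have "f' ` S \<subseteq> {..<f' \<mu>}" using less' sub assms(4) by (auto simp: S_def)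
  then have finS: "finite S" using injS by (meson finite_imageD finite_lessThan finite_subset)
  have zero: "(\<lambda>_. 0) \<in> ?E"
    using zeck_below.zero zeck_collection_iff_below[OF assms(1)] by blast
  \<comment> \<open>Since \<open>\<mu>\<close> is nonzero, \<open>S\<close> is nonempty and has an
    element \<open>c\<close> of maximal rank.\<close>
  have "(\<lambda>_. 0) \<in> S"
  proof -
    have "\<not> \<mu> <\<^sub>a (\<lambda>_. 0)" by (simp add: less_a_def)
    with zero sub assms(4,5) zeck_collection_less_a_total[OF assms(2)]
    show ?thesis by (force simp: S_def)
  qed
  then have "Max (f ` S) \<in> f ` S" using finS by (intro Max_in) auto
  then obtain c where "c \<in> S" "f c = Max (f ` S)" by auto
  then have c: "c \<in> S" "\<And>\<delta>. \<delta> \<in> S \<Longrightarrow> f \<delta> \<le> f c" using finS by auto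
  have cE: "c \<in> ?E" "c <\<^sub>a \<mu>" using c(1) by (auto simp: S_def)
  \<comment> \<open>\<open>S\<close> is an initial segment of \<open>?E\<close> up to
    \<open>c\<close>. The passage between \<open>f\<close> and \<open>f'\<close> goes through
    \<open><\<^sub>a\<close>, since both evaluations induce this order on \<open>?E\<close>.\<close>
  have S_iff: "\<delta> \<in> S \<longleftrightarrow> \<delta> \<in> ?E \<and> f \<delta> \<le> f c" for \<delta>
  proof
    assume "\<delta> \<in> ?E \<and> f \<delta> \<le> f c"
    then have \<delta>: "\<delta> \<in> ?E" "\<delta> = c \<or> \<delta> <\<^sub>a c" using less eq cE by (auto simp: le_less)
    then have "f' \<delta> \<le> f' c" using less' sub cE by auto
    also have "\<dots> < f' \<mu>" using less' sub cE assms(4) by blast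
    finally show "\<delta> \<in> S" using less' sub \<delta> assms(4) by (auto simp: S_def)
  qed (use c in \<open>auto simp: S_def\<close>)
  have check: "check_coeff ?E \<mu> = c"
    unfolding check_coeff_def
  proof (rule the_equality)
    show "c \<in> ?E \<and> c <\<^sub>a \<mu> \<and> (\<forall>\<delta>\<in>?E. \<delta> <\<^sub>a \<mu> \<longrightarrow> \<delta> = c \<or> \<delta> <\<^sub>a c)"
      using cE c(2) less eq by (auto simp: S_def le_less)
  next
    fix \<epsilon> assume *: "\<epsilon> \<in> ?E \<and> \<epsilon> <\<^sub>a \<mu> \<and> (\<forall>\<delta>\<in>?E. \<delta> <\<^sub>a \<mu> \<longrightarrow> \<delta> = \<epsilon> \<or> \<delta> <\<^sub>a \<epsilon>)"
    then have "f \<epsilon> \<le> f c" using c(2) by (simp add: S_def)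
    with * cE less show "\<epsilon> = c" by (metis not_less)
  qed
  \<comment> \<open>Ranks under \<open>f\<close> are exactly the natural numbers, so the immediate
    successor of \<open>c\<close> is the element of rank \<open>Suc (f c)\<close>.\<close>
  obtain b where b: "b \<in> ?E" "f b = Suc (f c)"
    using surj by (metis UNIV_I imageE)
  have bar: "bar_coeff ?E \<mu> = b"
    unfolding bar_coeff_def check
  proof (rule the_equality)
    show "b \<in> ?E \<and> c <\<^sub>a b \<and> (\<forall>\<delta>\<in>?E. c <\<^sub>a \<delta> \<longrightarrow> \<delta> = b \<or> b <\<^sub>a \<delta>)"
      using b cE less eq by auto
  next
    fix \<epsilon> assume *: "\<epsilon> \<in> ?E \<and> c <\<^sub>a \<epsilon> \<and> (\<forall>\<delta>\<in>?E. c <\<^sub>a \<delta> \<longrightarrow> \<delta> = \<epsilon> \<or> \<epsilon> <\<^sub>a \<delta>)"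
    then have "f c < f \<epsilon>" using less cE by blast
    moreover have "b = \<epsilon> \<or> f \<epsilon> < f b" using * b less cE by auto
    ultimately show "\<epsilon> = b" using b by auto
  qed
  \<comment> \<open>The ranks in \<open>S\<close> run from 0 to \<open>f c\<close>, so their number
    is \<open>Suc (f c) = f b\<close>.\<close>
  have "f ` S = {..<f b}"
  proof
    show "f ` S \<subseteq> {..<f b}" using b by (auto simp: S_iff)
    show "{..<f b} \<subseteq> f ` S"
    proof
      fix m assume "m \<in> {..<f b}"
      moreover obtain \<delta> where "\<delta> \<in> ?E" "m = f \<delta>"
        using surj by (metis UNIV_I imageE)
      ultimately show "m \<in> f ` S" using b by (auto simp: S_iff)
    qed
  qed
  moreover have "inj_on f S" using inj by (auto simp: S_def inj_on_def)
  ultimately have "card S = f b" using card_image by fastforce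
  with count bar show ?thesis by (simp add: f_def f'_def)
qed

end
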